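(* Let $I = B S_{\mu}$ be an inner function on the unit disk $\mathbb{D}$, where $B$ is the Blaschke factor, with zeros $\{\lambda_n\}_{n\ge 1}\subset\mathbb{D}$ repeated according to multiplicity, and $S_\mu$ is the singular inner factor with associated positive singular measure $\mu$ on $\mathbb{T}$. Let $\varphi$ be an admissible function and let $\zeta\in\mathbb{T}$. If $$\sum_{n\ge 1}\frac{1-|\lambda_n|}{\varphi(|\zeta-\lambda_n|)}+\int_{\mathbb{T}}\frac{1}{\varphi(|\zeta-e^{it}|)}\,d\mu(e^{it})<\infty,$$ then every $f\in (IH^2)^{\perp}$ satisfies $$|f(r\zeta)|\lesssim\frac{\sqrt{\varphi(1-r)}}{1-r},\qquad r\in(0,1),$$ that is, for every $f\in(IH^2)^\perp$ there is a constant $C>0$, independent of $r$, such that $|f(r\zeta)|\le C\,\sqrt{\varphi(1-r)}/(1-r)$ for all $r\in(0,1)$.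
   Context: $\mathbb{D}$ is the open unit disk in $\mathbb{C}$ and $\mathbb{T}$ is the unit circle. $H^2$ is the classical Hardy space on $\mathbb{D}$, and $(IH^2)^\perp$ denotes the orthogonal complement of $IH^2$ in $H^2$ (the model space of $I$). For a positive finite measure $\mu$ on $\mathbb{T}$, singular with respect to Lebesgue measure, $$S_\mu(z)=\exp\left(-\int_{\mathbb{T}}\frac{e^{it}+z}{e^{it}-z}\,d\mu(e^{it})\right),\quad z\in\mathbb{D}.$$ A function $\varphi:(0,+\infty)\to\mathbb{R}^+$ is called admissible if it is positive, increasing, and satisfies: (1) $x\mapsto \varphi(x)/x$ is bounded; (2) $x\mapsto\varphi(x)/x^2$ is decreasing; (3) $\varphi(x)\asymp\varphi(x+o(x))$ as $x\downarrow 0$, i.e. for every real function $h$ with $h(x)=o(x)$ as $x\downarrow0$, the ratio $\varphi(x+h(x))/\varphi(x)$ is bounded above and bounded away from $0$ for all sufficiently small $x>0$. Convention: $1/\varphi(0)=+\infty$, so that finiteness of the integral in the hypothesis includes $\mu(\{\zeta\})=0$. *)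

theory Defs
  imports "HOL-Complex_Analysis.Complex_Analysis" "HOL-Library.Landau_Symbols"
begin

text \<open>
  Elements of the Hardy space of the unit disk are represented by functions on the whole complex
  plane; their values outside the open disk are irrelevant to every notion below.
\<close>

definition hardy2 :: "(complex \<Rightarrow> complex) set" where
  "hardy2 = {f. f holomorphic_on ball 0 1 \<and> summable (\<lambda>n. (cmod (fps_nth (fps_expansion f 0) n))\<^sup>2)}"

definition hardy2_inner :: "(complex \<Rightarrow> complex) \<Rightarrow> (complex \<Rightarrow> complex) \<Rightarrow> complex" where
  "hardy2_inner f g = (\<Sum>n. fps_nth (fps_expansion f 0) n * cnj (fps_nth (fps_expansion g 0) n))"

definition model_space :: "(complex \<Rightarrow> complex) \<Rightarrow> (complex \<Rightarrow> complex) set" where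
  "model_space I = {f \<in> hardy2. \<forall>g \<in> hardy2. hardy2_inner f (\<lambda>z. I z * g z) = 0}"

abbreviation circle_borel :: "complex measure" where
  "circle_borel \<equiv> restrict_space borel (sphere 0 1)"

definition arc_length :: "complex measure" where
  "arc_length = distr (restrict_space lborel {0..<2 * pi}) circle_borel cis"

definition singular_circle_measure :: "complex measure \<Rightarrow> bool" where
  "singular_circle_measure \<mu> \<longleftrightarrow>
     sets \<mu> = sets circle_borel \<and> finite_measure \<mu> \<and>
     (\<exists>A \<in> sets circle_borel. emeasure arc_length A = 0 \<and> emeasure \<mu> (sphere 0 1 - A) = 0)"

definition inner_function :: "(complex \<Rightarrow> complex) \<Rightarrow> bool" where
  "inner_function I \<longleftrightarrow>
     I holomorphic_on ball 0 1 \<and> bounded (I ` ball 0 1) \<and>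
     (AE w in arc_length. \<exists>l. cmod l = 1 \<and> ((\<lambda>r. I (of_real r * w)) \<longlongrightarrow> l) (at_left 1))"

definition blaschke_factor :: "complex \<Rightarrow> complex \<Rightarrow> complex" where
  "blaschke_factor a z =
     (if a = 0 then z else of_real (cmod a) / a * ((a - z) / (1 - cnj a * z)))"

text \<open>
  The zeros are a family indexed by a set of natural numbers \<open>J\<close>, so that finite (in particular
  empty) and infinite zero sequences are treated uniformly; repetitions encode multiplicities.
\<close>

definition blaschke_sequence :: "nat set \<Rightarrow> (nat \<Rightarrow> complex) \<Rightarrow> bool" where
  "blaschke_sequence J a \<longleftrightarrow>
     (\<forall>n\<in>J. a n \<in> ball 0 1) \<and> (\<lambda>n. 1 - cmod (a n)) summable_on J"

definition blaschke_product :: "nat set \<Rightarrow> (nat \<Rightarrow> complex) \<Rightarrow> complex \<Rightarrow> complex" where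
  "blaschke_product J a z = (\<Prod>n. if n \<in> J then blaschke_factor (a n) z else 1)"

definition singular_inner :: "complex measure \<Rightarrow> complex \<Rightarrow> complex" where
  "singular_inner \<mu> z = exp (- (LINT w|\<mu>. (w + z) / (w - z)))"

text \<open>
  Monotonicity is meant in the weak sense. Only the values on the positive half-line matter:
  \<open>x + h x\<close> is positive for all small \<open>x > 0\<close>.
\<close>

definition admissible :: "(real \<Rightarrow> real) \<Rightarrow> bool" where
  "admissible \<phi> \<longleftrightarrow>
     (\<forall>x>0. \<phi> x > 0) \<and>
     mono_on {0<..} \<phi> \<and>
     bounded ((\<lambda>x. \<phi> x / x) ` {0<..}) \<and>
     antimono_on {0<..} (\<lambda>x. \<phi> x / x\<^sup>2) \<and>
     (\<forall>h. h \<in> o[at_right 0](\<lambda>x. x) \<longrightarrow> (\<lambda>x. \<phi> (x + h x)) \<in> \<Theta>[at_right 0](\<phi>))"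

text \<open>The reciprocal of \<open>\<phi>\<close> on the closed half-line, with the convention \<open>1 / \<phi> 0 = \<infinity>\<close>.\<close>

definition recip_ext :: "(real \<Rightarrow> real) \<Rightarrow> real \<Rightarrow> ennreal" where
  "recip_ext \<phi> x = (if x = 0 then \<infinity> else ennreal (1 / \<phi> x))"

end

(*
  The reproducing kernel of the model space gives
    |f(z)|^2 <= ||f||^2 (1 - |I(z)|^2) / (1 - |z|^2),
  which needs only |I| <= 1: subtracting conj(I(z)) I k_z, which f annihilates, from the Szego kernel
  k_z leaves a function of squared norm at most (1 - |I(z)|^2) / (1 - |z|^2).
  By 1 - prod (1 - x_n) <= sum x_n and 1 - exp(-x) <= x, the quantity 1 - |I(z)|^2 is at most
    sum (1 - |z|^2)(1 - |l_n|^2) / |1 - conj(l_n) z|^2 + 2 int (1 - |z|^2) / |w - z|^2 dmu(w).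
  For z = r zeta both kernels are compared with 1/phi(|zeta - .|): as |1 - conj(w) z| dominates
  1 - r and |zeta - w| / 2, the monotonicity of phi and of phi(x)/x^2 gives
    1 / |1 - conj(w) z|^2 <= 4 phi(1 - r) / ((1 - r)^2 phi(|zeta - w|)).
*)
theory Submission
  imports Defs
begin

section \<open>Taylor coefficients and Parseval's identity on circles inside the disk\<close>

abbreviation taylor :: "(complex \<Rightarrow> complex) \<Rightarrow> nat \<Rightarrow> complex" where
  "taylor f n \<equiv> fps_nth (fps_expansion f 0) n"

lemma taylor_sums:
  assumes "f holomorphic_on ball 0 1" "cmod z < 1"
  shows "(\<lambda>n. taylor f n * z ^ n) sums f z"
    and "summable (\<lambda>n. cmod (taylor f n * z ^ n))"
proof -
  have h: "f holomorphic_on eball 0 (ereal 1)" using assms by simp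
  have r: "ereal (cmod z) < fps_conv_radius (fps_expansion f 0)"
    using assms(2) by (intro less_le_trans[OF _ conv_radius_fps_expansion[OF h]]) simp
  show "summable (\<lambda>n. cmod (taylor f n * z ^ n))"
    by (rule norm_summable_fps[OF r])
  have "eval_fps (fps_expansion f 0) z = f (0 + z)"
    by (rule eval_fps_expansion'[OF h]) (use assms in auto)
  with sums_eval_fps[OF r] show "(\<lambda>n. taylor f n * z ^ n) sums f z" by simp
qed

text \<open>This is Cauchy's formula for the derivative of order \<open>n\<close> at 0, rewritten as
  a Fourier coefficient of \<open>f\<close> on the circle of radius \<open>r\<close>.\<close>

lemma taylor_has_integral:
  assumes "f holomorphic_on ball 0 1" "0 < r" "r < 1"
  shows "((\<lambda>t. f (of_real r * cis t) * cnj (cis t) ^ n)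
           has_integral 2 * pi * (taylor f n * of_real r ^ n)) {0..2 * pi}"
proof -
  have h: "f holomorphic_on cball 0 r"
    using assms by (auto intro: holomorphic_on_subset)
  have "((\<lambda>u. f u / (u - 0) ^ Suc n) has_contour_integral
          (2 * pi * \<i>) / fact n * (deriv ^^ n) f 0) (circlepath 0 r)"
    using h assms(2)
    by (intro Cauchy_has_contour_integral_higher_derivative_circlepath)
       (auto intro: holomorphic_on_imp_continuous_on holomorphic_on_subset)
  hence "((\<lambda>t. f (0 + of_real r * cis t) / (0 + of_real r * cis t - 0) ^ Suc n * of_real r * \<i> * cis t)
          has_integral (2 * pi * \<i>) / fact n * (deriv ^^ n) f 0) {0..2 * pi}"
    unfolding circlepath_def
    by (subst (asm) has_contour_integral_part_circlepath_iff) auto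
  \<comment> \<open>The factor \<open>of_real r ^ n / \<i>\<close> clears the radius and the \<i>
    coming from the path, so that the Cauchy kernel becomes \<open>cnj (cis t) ^ n\<close>.\<close>
  hence "((\<lambda>t. f (0 + of_real r * cis t) / (0 + of_real r * cis t - 0) ^ Suc n * of_real r * \<i> * cis t
              * (of_real r ^ n / \<i>))
          has_integral (2 * pi * \<i>) / fact n * (deriv ^^ n) f 0 * (of_real r ^ n / \<i>)) {0..2 * pi}"
    by (rule has_integral_mult_left)
  also have "(2 * pi * \<i>) / fact n * (deriv ^^ n) f 0 * (of_real r ^ n / \<i>)
               = 2 * pi * (taylor f n * of_real r ^ n)"
    by (simp add: fps_expansion_def field_simps)
  also have "(\<lambda>t. f (0 + of_real r * cis t) / (0 + of_real r * cis t - 0) ^ Suc n * of_real r * \<i> * cis t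
              * (of_real r ^ n / \<i>)) = (\<lambda>t. f (of_real r * cis t) * cnj (cis t) ^ n)"
    using assms(2) by (auto simp: fun_eq_iff power_mult_distrib cis_cnj cis_inverse[symmetric] field_simps)
  finally show ?thesis by simp
qed

text \<open>Only one factor of \<open>F t * cnj (F t)\<close> is expanded in its Taylor series.
  Integrating term by term then leaves a single series, each term of which is a conjugated Fourier
  coefficient of \<open>f\<close>.\<close>

lemma parseval_circle:
  assumes f: "f holomorphic_on ball 0 1" and r: "0 < r" "r < 1"
  shows "(\<lambda>t. (cmod (f (of_real r * cis t)))\<^sup>2) integrable_on {0..2 * pi}"
    and "(\<lambda>n. (cmod (taylor f n))\<^sup>2 * r ^ (2 * n)) sums
           (integral {0..2 * pi} (\<lambda>t. (cmod (f (of_real r * cis t)))\<^sup>2) / (2 * pi))"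
proof -
  define F where "F t = f (of_real r * cis t)" for t
  have cF: "continuous_on A F" for A
    unfolding F_def
    by (rule continuous_on_compose2[OF holomorphic_on_imp_continuous_on[OF f]])
       (use r in \<open>auto intro!: continuous_intros simp: norm_mult\<close>)
  have "bounded (F ` {0..2 * pi})"
    by (intro compact_imp_bounded compact_continuous_image cF compact_Icc)
  then obtain M where M: "\<And>t. t \<in> {0..2*pi} \<Longrightarrow> cmod (F t) \<le> M"
    unfolding bounded_iff by blast
  define u where "u n t = taylor f n * (of_real r * cis t) ^ n * cnj (F t)" for n t
  \<comment> \<open>Uniform convergence justifies the termwise integration. The majorant is the
    absolutely convergent Taylor series at radius \<open>r\<close>, times a bound \<open>M\<close>
    for \<open>F\<close> on the circle.\<close>
  have "uniform_limit {0..2*pi} (\<lambda>N t. \<Sum>n<N. u n t) (\<lambda>t. suminf (\<lambda>n. u n t)) sequentially"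
  proof (rule Weierstrass_m_test)
    show "cmod (u n t) \<le> cmod (taylor f n * of_real r ^ n) * M" if "t \<in> {0..2*pi}" for n t
      using M[OF that] r
      by (auto simp: u_def norm_mult norm_power power_mult_distrib intro!: mult_left_mono)
    show "summable (\<lambda>n. cmod (taylor f n * of_real r ^ n) * M)"
      using taylor_sums(2)[OF f, of "of_real r"] r by (intro summable_mult2) auto
  qed
  moreover have "suminf (\<lambda>n. u n t) = of_real ((cmod (F t))\<^sup>2)" for t
  proof -
    have "(\<lambda>n. u n t) sums (F t * cnj (F t))"
      unfolding u_def F_def
      by (rule sums_mult2, rule taylor_sums(1)[OF f]) (use r in \<open>simp add: norm_mult\<close>)
    thus ?thesis by (simp add: sums_iff complex_norm_square del: of_real_power)
  qed
  ultimately have ul: "uniform_limit {0..2*pi} (\<lambda>N t. \<Sum>n<N. u n t)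
                         (\<lambda>t. of_real ((cmod (F t))\<^sup>2)) sequentially"
    by simp
  have cu: "continuous_on {0..2*pi} (\<lambda>t. \<Sum>n<N. u n t)" for N
    unfolding u_def by (intro continuous_intros cF)
  obtain A J where A: "\<And>N. ((\<lambda>t. \<Sum>n<N. u n t) has_integral A N) {0..2*pi}"
    and J: "((\<lambda>t. complex_of_real ((cmod (F t))\<^sup>2)) has_integral J) {0..2*pi}"
    and AJ: "A \<longlonglongrightarrow> J"
    using uniform_limit_integral[OF ul cu] by auto
  have u_int: "(u n has_integral of_real (2 * pi * ((cmod (taylor f n))\<^sup>2 * r ^ (2 * n)))) {0..2*pi}" for n
  proof -
    have "((\<lambda>t. cnj (F t * cnj (cis t) ^ n)) has_integral
             cnj (2 * pi * (taylor f n * of_real r ^ n))) {0..2 * pi}"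
      using taylor_has_integral[OF f r, of n] unfolding F_def
      by (rule has_integral_cnj[THEN iffD2, unfolded comp_def])
    hence "((\<lambda>t. taylor f n * of_real r ^ n * cnj (F t * cnj (cis t) ^ n)) has_integral
             taylor f n * of_real r ^ n * cnj (2 * pi * (taylor f n * of_real r ^ n))) {0..2 * pi}"
      by (rule has_integral_mult_right)
    also have "(\<lambda>t. taylor f n * of_real r ^ n * cnj (F t * cnj (cis t) ^ n)) = u n"
      by (auto simp: fun_eq_iff u_def power_mult_distrib)
    also have "taylor f n * of_real r ^ n * cnj (2 * pi * (taylor f n * of_real r ^ n))
                 = of_real (2 * pi * ((cmod (taylor f n))\<^sup>2 * r ^ (2 * n)))"
      unfolding of_real_mult complex_norm_square
      by (simp add: power_even_eq power2_eq_square)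
    finally show ?thesis .
  qed
  have "A N = of_real (\<Sum>n<N. 2 * pi * ((cmod (taylor f n))\<^sup>2 * r ^ (2 * n)))" for N
    unfolding of_real_sum
    by (rule has_integral_unique[OF A]) (intro has_integral_sum u_int finite_lessThan)
  hence AR: "(\<lambda>N. Re (A N)) = (\<lambda>N. \<Sum>n<N. 2 * pi * ((cmod (taylor f n))\<^sup>2 * r ^ (2 * n)))"
    by auto
  have JR: "((\<lambda>t. (cmod (F t))\<^sup>2) has_integral Re J) {0..2*pi}"
    using has_integral_Re[OF J] by simp
  thus "(\<lambda>t. (cmod (f (of_real r * cis t)))\<^sup>2) integrable_on {0..2 * pi}"
    unfolding F_def by (rule has_integral_integrable)
  have "(\<lambda>n. 2 * pi * ((cmod (taylor f n))\<^sup>2 * r ^ (2 * n))) sums Re J"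
    unfolding sums_def AR[symmetric] by (rule tendsto_Re[OF AJ])
  from sums_divide[OF this, of "2 * pi"]
  have "(\<lambda>n. (cmod (taylor f n))\<^sup>2 * r ^ (2 * n)) sums (Re J / (2 * pi))"
    by simp
  thus "(\<lambda>n. (cmod (taylor f n))\<^sup>2 * r ^ (2 * n)) sums
           (integral {0..2 * pi} (\<lambda>t. (cmod (f (of_real r * cis t)))\<^sup>2) / (2 * pi))"
    using integral_unique[OF JR] unfolding F_def by metis
qed

section \<open>Contractive multipliers, the Szego kernel and the pointwise bound on the model
  space\<close>

lemma hardy2_mult_contraction:
  assumes I: "I holomorphic_on ball 0 1" "\<And>z. z \<in> ball 0 1 \<Longrightarrow> cmod (I z) \<le> 1"
    and g: "g \<in> hardy2"
  shows "(\<lambda>z. I z * g z) \<in> hardy2"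
    and "(\<Sum>n. (cmod (taylor (\<lambda>z. I z * g z) n))\<^sup>2) \<le> (\<Sum>n. (cmod (taylor g n))\<^sup>2)"
proof -
  define p where "p = (\<lambda>z. I z * g z)"
  have gh: "g holomorphic_on ball 0 1" and gs: "summable (\<lambda>n. (cmod (taylor g n))\<^sup>2)"
    using g by (auto simp: hardy2_def)
  have ph: "p holomorphic_on ball 0 1" unfolding p_def by (intro holomorphic_intros I gh)
  define S where "S = (\<Sum>n. (cmod (taylor g n))\<^sup>2)"
  \<comment> \<open>On the circle of radius \<open>r\<close> the inequality is pointwise, since
    \<open>I\<close> has modulus at most 1 there; Parseval carries it over to weighted coefficient
    sums.\<close>
  have bound_r: "(\<Sum>n<N. (cmod (taylor p n))\<^sup>2 * r ^ (2 * n)) \<le> S" if r: "0 < r" "r < 1" for N r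
  proof -
    note P = parseval_circle[OF ph r] and G = parseval_circle[OF gh r]
    have "(\<Sum>n<N. (cmod (taylor p n))\<^sup>2 * r ^ (2 * n)) \<le>
            (\<Sum>n. (cmod (taylor p n))\<^sup>2 * r ^ (2 * n))"
      using P(2) r by (intro sum_le_suminf) (auto simp: sums_iff)
    also have "\<dots> = integral {0..2 * pi} (\<lambda>t. (cmod (p (of_real r * cis t)))\<^sup>2) / (2 * pi)"
      using P(2) by (simp add: sums_iff)
    also have "\<dots> \<le> integral {0..2 * pi} (\<lambda>t. (cmod (g (of_real r * cis t)))\<^sup>2) / (2 * pi)"
    proof (intro divide_right_mono integral_le P(1) G(1))
      fix t
      have "cmod (I (of_real r * cis t)) \<le> 1" using r by (intro I) (simp add: norm_mult)
      thus "(cmod (p (of_real r * cis t)))\<^sup>2 \<le> (cmod (g (of_real r * cis t)))\<^sup>2"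
        by (auto simp: p_def norm_mult intro!: power_mono mult_left_le_one_le)
    qed auto
    also have "\<dots> = (\<Sum>n. (cmod (taylor g n))\<^sup>2 * r ^ (2 * n))"
      using G(2) by (simp add: sums_iff)
    also have "\<dots> \<le> S"
      unfolding S_def using G(2) gs r
      by (intro suminf_le) (auto simp: sums_iff power_le_one intro!: mult_right_le_one_le)
    finally show ?thesis .
  qed
  \<comment> \<open>For fixed \<open>N\<close> the sum is a polynomial in \<open>r\<close>, so
    letting \<open>r\<close> tend to 1 removes the weights without interchanging limits. Summability
    follows because \<open>S\<close> does not depend on \<open>N\<close>.\<close>
  have bound: "(\<Sum>n<N. (cmod (taylor p n))\<^sup>2) \<le> S" for N
  proof (rule tendsto_upperbound)
    show "((\<lambda>r. \<Sum>n<N. (cmod (taylor p n))\<^sup>2 * r ^ (2 * n)) \<longlongrightarrow> (\<Sum>n<N. (cmod (taylor p n))\<^sup>2)) (at_left 1)"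
      by (auto intro!: tendsto_eq_intros)
    show "\<forall>\<^sub>F r in at_left 1. (\<Sum>n<N. (cmod (taylor p n))\<^sup>2 * r ^ (2 * n)) \<le> S"
      using eventually_at_left_real[of 0 "1::real"]
      by (auto elim!: eventually_mono intro!: bound_r)
  qed auto
  have ps: "summable (\<lambda>n. (cmod (taylor p n))\<^sup>2)"
    by (rule summableI_nonneg_bounded[of _ S]) (use bound in auto)
  show "(\<lambda>z. I z * g z) \<in> hardy2"
    using ph ps by (simp add: hardy2_def p_def)
  show "(\<Sum>n. (cmod (taylor (\<lambda>z. I z * g z) n))\<^sup>2) \<le> (\<Sum>n. (cmod (taylor g n))\<^sup>2)"
    using suminf_le_const[OF ps, of S] bound by (simp add: p_def S_def)
qed

text \<open>The pairing is bilinear. For the Hardy inner product the conjugate is put into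
  \<open>b\<close>, which leaves the moduli unchanged.\<close>

lemma cauchy_schwarz_suminf:
  fixes a b :: "nat \<Rightarrow> complex"
  assumes a: "summable (\<lambda>n. (cmod (a n))\<^sup>2)" and b: "summable (\<lambda>n. (cmod (b n))\<^sup>2)"
  shows "summable (\<lambda>n. a n * b n)"
    and "(cmod (\<Sum>n. a n * b n))\<^sup>2 \<le> (\<Sum>n. (cmod (a n))\<^sup>2) * (\<Sum>n. (cmod (b n))\<^sup>2)"
proof -
  show s: "summable (\<lambda>n. a n * b n)"
  proof (rule summable_comparison_test'[OF summable_add[OF a b]])
    show "cmod (a n * b n) \<le> (cmod (a n))\<^sup>2 + (cmod (b n))\<^sup>2" for n
      using sum_squares_bound[of "cmod (a n)" "cmod (b n)"]
        mult_nonneg_nonneg[OF norm_ge_zero[of "a n"] norm_ge_zero[of "b n"]]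
      unfolding norm_mult by linarith
  qed
  show "(cmod (\<Sum>n. a n * b n))\<^sup>2 \<le> (\<Sum>n. (cmod (a n))\<^sup>2) * (\<Sum>n. (cmod (b n))\<^sup>2)"
  proof (rule LIMSEQ_le_const2)
    show "(\<lambda>N. (cmod (\<Sum>n<N. a n * b n))\<^sup>2) \<longlonglongrightarrow> (cmod (\<Sum>n. a n * b n))\<^sup>2"
      by (intro tendsto_intros summable_LIMSEQ s)
    have "(cmod (\<Sum>n<N. a n * b n))\<^sup>2 \<le> (\<Sum>n. (cmod (a n))\<^sup>2) * (\<Sum>n. (cmod (b n))\<^sup>2)" for N
    proof -
      have "(cmod (\<Sum>n<N. a n * b n))\<^sup>2 \<le> (\<Sum>n<N. cmod (a n) * cmod (b n))\<^sup>2"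
        by (intro power_mono order_trans[OF norm_sum]) (auto simp: norm_mult)
      also have "\<dots> \<le> (\<Sum>n<N. (cmod (a n))\<^sup>2) * (\<Sum>n<N. (cmod (b n))\<^sup>2)"
        by (rule Cauchy_Schwarz_ineq_sum)
      also have "\<dots> \<le> (\<Sum>n. (cmod (a n))\<^sup>2) * (\<Sum>n. (cmod (b n))\<^sup>2)"
        by (intro mult_mono sum_le_suminf a b sum_nonneg suminf_nonneg) auto
      finally show ?thesis .
    qed
    thus "\<exists>N. \<forall>n\<ge>N. (cmod (\<Sum>n<n. a n * b n))\<^sup>2 \<le> (\<Sum>n. (cmod (a n))\<^sup>2) * (\<Sum>n. (cmod (b n))\<^sup>2)"
      by blast
  qed
qed

text \<open>The kernel is a geometric series in \<open>cnj z * w\<close>. With these coefficients,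
  the inner product of a function with \<open>k\<close> is its Taylor series at \<open>z\<close>,
  hence its value there.\<close>

lemma szego_kernel:
  assumes z: "cmod z < 1"
  defines "k \<equiv> \<lambda>w. 1 / (1 - cnj z * w)"
  shows "taylor k n = cnj z ^ n"
    and "k \<in> hardy2"
    and "(\<lambda>n. (cmod (taylor k n))\<^sup>2) sums (1 / (1 - (cmod z)\<^sup>2))"
proof -
  have "k has_fps_expansion (inverse (1 - fps_const (cnj z) * fps_X))"
    unfolding k_def divide_inverse mult_1
    by (intro fps_expansion_intros) auto
  hence e: "fps_expansion k 0 = inverse (1 - fps_const (cnj z) * fps_X)"
    by (rule fps_expansion_eqI)
  have "Abs_fps (\<lambda>n. cnj z ^ n) * (1 - fps_const (cnj z) * fps_X) = 1"
    by (rule fps_ext) (auto simp: algebra_simps fps_mult_fps_X_deriv_shift power_eq_if)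
  hence "inverse (1 - fps_const (cnj z) * fps_X) = Abs_fps (\<lambda>n. cnj z ^ n)"
    by (metis fps_inverse_unique mult.commute)
  thus t: "taylor k n = cnj z ^ n" for n using e by simp
  have "(\<lambda>n. ((cmod z)\<^sup>2) ^ n) sums (1 / (1 - (cmod z)\<^sup>2))"
    by (rule geometric_sums) (use z in \<open>simp add: power_less_one_iff\<close>)
  thus s: "(\<lambda>n. (cmod (taylor k n))\<^sup>2) sums (1 / (1 - (cmod z)\<^sup>2))"
    by (simp add: t norm_power power_mult[symmetric] mult.commute)
  have nz: "cnj z * w \<noteq> 1" if "cmod w < 1" for w
  proof
    assume "cnj z * w = 1"
    hence "cmod z * cmod w = 1" by (metis complex_mod_cnj norm_mult norm_one)
    thus False using z that mult_strict_mono'[of "cmod z" 1 "cmod w" 1] by simp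
  qed
  have "k holomorphic_on ball 0 1"
    unfolding k_def using nz by (intro holomorphic_intros) (simp add: eq_commute[of 1])
  thus "k \<in> hardy2" using s by (auto simp: hardy2_def sums_iff)
qed

text \<open>The cross term is written with \<open>b * cnj a\<close> so that, for
  \<open>a = cnj z ^ n\<close>, it becomes a term of a Taylor series at \<open>z\<close>.\<close>

lemma cmod_diff_power2: "(cmod (a - b))\<^sup>2 = (cmod a)\<^sup>2 - 2 * Re (b * cnj a) + (cmod b)\<^sup>2"
  unfolding cmod_power2 by (simp add: power2_eq_square algebra_simps)

lemma model_space_pointwise_bound:
  assumes I: "I holomorphic_on ball 0 1" "\<And>z. z \<in> ball 0 1 \<Longrightarrow> cmod (I z) \<le> 1"
    and f: "f \<in> model_space I" and z: "cmod z < 1"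
  shows "(cmod (f z))\<^sup>2 \<le> (\<Sum>n. (cmod (taylor f n))\<^sup>2) * ((1 - (cmod (I z))\<^sup>2) / (1 - (cmod z)\<^sup>2))"
proof -
  define k where "k = (\<lambda>w. 1 / (1 - cnj z * w))"
  note k = szego_kernel[OF z, folded k_def]
  define p where "p = (\<lambda>w. I w * k w)"
  note p = hardy2_mult_contraction[OF I k(2), folded p_def]
  have fh: "f holomorphic_on ball 0 1" and fs: "summable (\<lambda>n. (cmod (taylor f n))\<^sup>2)"
    using f by (auto simp: model_space_def hardy2_def)
  have ph: "p holomorphic_on ball 0 1" and ps: "summable (\<lambda>n. (cmod (taylor p n))\<^sup>2)"
    using p(1) by (auto simp: hardy2_def)
  define c where "c = cnj (I z)"
  define K where "K = 1 / (1 - (cmod z)\<^sup>2)"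
  \<comment> \<open>\<open>h n\<close> is the conjugate of the coefficient of order \<open>n\<close>
    of \<open>k - c p\<close>. For inner \<open>I\<close> this difference is the reproducing kernel
    of the model space at \<open>z\<close>.\<close>
  define h where "h n = cnj (cnj z ^ n - c * taylor p n)" for n
  have "(\<lambda>n. taylor f n * cnj (taylor p n)) sums 0"
    using f k(2) cauchy_schwarz_suminf(1)[OF fs, of "\<lambda>n. cnj (taylor p n)"] ps
    by (auto simp: model_space_def hardy2_inner_def p_def sums_iff)
  \<comment> \<open>Since \<open>f\<close> is orthogonal to \<open>p\<close>, subtracting a multiple
    of \<open>p\<close> from the kernel does not change the value it reproduces.\<close>
  from sums_diff[OF taylor_sums(1)[OF fh z] sums_mult[OF this, of "cnj c"]]
  have fz: "(\<lambda>n. taylor f n * h n) sums f z"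
    by (simp add: h_def algebra_simps)
  \<comment> \<open>The cross term is the reproducing property applied to \<open>p\<close> itself,
    whose value at \<open>z\<close> is \<open>I z * K\<close>.\<close>
  have "k z = of_real K" 
    using complex_norm_square[of z] by (simp add: k_def K_def mult.commute)
  hence "(\<lambda>n. c * (taylor p n * z ^ n)) sums (c * (I z * K))"
    using sums_mult[OF taylor_sums(1)[OF ph z], of c] by (simp add: p_def)
  also have "c * (I z * K) = of_real ((cmod (I z))\<^sup>2 * K)"
    using complex_norm_square[of "I z"] by (simp add: c_def mult.commute mult.left_commute)
  finally have cross: "(\<lambda>n. Re (c * (taylor p n * z ^ n))) sums ((cmod (I z))\<^sup>2 * K)"
    using sums_Re by fastforce
  define P where "P = (\<Sum>n. (cmod (taylor p n))\<^sup>2)"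
  have kk: "(\<lambda>n. (cmod z ^ n)\<^sup>2) sums K"
    using k(3) by (simp add: k(1) K_def norm_power)
  have PK: "P \<le> K" using p(2) k(3) by (simp add: P_def K_def sums_iff)
  have "(\<lambda>n. (cmod z ^ n)\<^sup>2 - 2 * Re (c * (taylor p n * z ^ n)) + (cmod c)\<^sup>2 * (cmod (taylor p n))\<^sup>2)
          sums (K - 2 * ((cmod (I z))\<^sup>2 * K) + (cmod c)\<^sup>2 * P)"
    unfolding P_def by (intro sums_add sums_diff sums_mult kk cross summable_sums ps)
  also have "(\<lambda>n. (cmod z ^ n)\<^sup>2 - 2 * Re (c * (taylor p n * z ^ n)) + (cmod c)\<^sup>2 * (cmod (taylor p n))\<^sup>2)
          = (\<lambda>n. (cmod (h n))\<^sup>2)"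
  proof
    fix n
    show "(cmod z ^ n)\<^sup>2 - 2 * Re (c * (taylor p n * z ^ n)) + (cmod c)\<^sup>2 * (cmod (taylor p n))\<^sup>2 = (cmod (h n))\<^sup>2"
      unfolding h_def complex_mod_cnj cmod_diff_power2
      by (simp add: norm_power norm_mult power_mult_distrib mult_ac)
  qed
  finally have hs: "(\<lambda>n. (cmod (h n))\<^sup>2) sums (K - 2 * ((cmod (I z))\<^sup>2 * K) + (cmod c)\<^sup>2 * P)" .
  have "(cmod (f z))\<^sup>2 \<le> (\<Sum>n. (cmod (taylor f n))\<^sup>2) * (\<Sum>n. (cmod (h n))\<^sup>2)"
    using cauchy_schwarz_suminf(2)[OF fs, of h] fz hs by (simp add: sums_iff)
  \<comment> \<open>The squared norm is K - 2 |I(z)|^2 K + |I(z)|^2 P. Replacing P by the larger K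
    cancels one of the two copies of |I(z)|^2 K.\<close>
  also have "(\<Sum>n. (cmod (h n))\<^sup>2) \<le> (1 - (cmod (I z))\<^sup>2) * K"
    using hs mult_left_mono[OF PK, of "(cmod (I z))\<^sup>2"]
    by (simp add: sums_iff c_def algebra_simps)
  finally show ?thesis
    using fs by (simp add: K_def mult_left_mono suminf_nonneg)
qed

section \<open>Blaschke factors and Blaschke products\<close>

lemma norm_one_minus_cnj_mult:
  "(cmod (1 - cnj a * z))\<^sup>2 - (cmod (a - z))\<^sup>2 = (1 - (cmod a)\<^sup>2) * (1 - (cmod z)\<^sup>2)"
  unfolding cmod_power2 by (simp add: power2_eq_square algebra_simps)

lemma one_minus_cnj_mult_nonzero:
  assumes "cmod a \<le> 1" "cmod z < 1"
  shows "1 - cnj a * z \<noteq> 0"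
proof
  assume "1 - cnj a * z = 0"
  hence "cmod (cnj a * z) = 1" by simp
  moreover have "cmod (cnj a * z) \<le> cmod z"
    using assms by (auto simp: norm_mult intro: mult_left_le_one_le)
  ultimately show False using assms(2) by simp
qed

lemma blaschke_factor_norm:
  assumes "cmod a < 1" "cmod z < 1"
  shows "1 - (cmod (blaschke_factor a z))\<^sup>2 = (1 - (cmod a)\<^sup>2) * (1 - (cmod z)\<^sup>2) / (cmod (1 - cnj a * z))\<^sup>2"
proof (cases "a = 0")
  case True
  thus ?thesis by (simp add: blaschke_factor_def)
next
  case False
  have nz: "cmod (1 - cnj a * z) \<noteq> 0" using one_minus_cnj_mult_nonzero[of a z] assms by simp
  have "cmod (blaschke_factor a z) = cmod (a - z) / cmod (1 - cnj a * z)"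
    using False by (simp add: blaschke_factor_def norm_mult norm_divide)
  thus ?thesis
    using nz unfolding norm_one_minus_cnj_mult[symmetric] by (simp add: power_divide diff_divide_distrib)
qed

lemma blaschke_factor_norm_le_1:
  assumes "cmod a < 1" "cmod z < 1"
  shows "cmod (blaschke_factor a z) \<le> 1"
proof -
  have "(cmod a)\<^sup>2 \<le> 1" "(cmod z)\<^sup>2 \<le> 1" using assms by (auto simp: power_le_one)
  hence "0 \<le> 1 - (cmod (blaschke_factor a z))\<^sup>2"
    unfolding blaschke_factor_norm[OF assms] by simp
  thus ?thesis by (simp add: power_le_one_iff)
qed

text \<open>For fixed \<open>z\<close> this dominates the distance of the factors from 1 by a
  multiple of the Blaschke sum, which yields absolute convergence of the product.\<close>

lemma blaschke_factor_minus_1: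
  assumes a: "cmod a < 1" and z: "cmod z < 1"
  shows "cmod (blaschke_factor a z - 1) \<le> 2 / (1 - cmod z) * (1 - cmod a)"
proof (cases "a = 0")
  case True
  have "cmod (z - 1) \<le> 2" using norm_triangle_ineq4[of z 1] z by simp
  also have "2 \<le> 2 / (1 - cmod z)" using z by (simp add: field_simps)
  finally show ?thesis using True by (simp add: blaschke_factor_def)
next
  case False
  have nz: "1 - cnj a * z \<noteq> 0" using one_minus_cnj_mult_nonzero[of a z] assms by simp
  have aa: "a * cnj a = (of_real (cmod a))\<^sup>2" using complex_norm_square[of a] by simp
  have "blaschke_factor a z - 1 = (of_real (cmod a) * (a - z) - a * (1 - cnj a * z)) / (a * (1 - cnj a * z))"
    using False nz by (simp add: blaschke_factor_def divide_simps)
  \<comment> \<open>Replacing \<open>a * cnj a\<close> by the squared modulus lets the small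
    quantity \<open>1 - cmod a\<close> be factored out of the numerator.\<close>
  also have "of_real (cmod a) * (a - z) - a * (1 - cnj a * z)
               = - (of_real (1 - cmod a) * (a + of_real (cmod a) * z))"
  proof -
    have expand: "a * (1 - cnj a * z) = a - (of_real (cmod a))\<^sup>2 * z"
      by (simp only: aa[symmetric] right_diff_distrib mult_1_right mult.assoc)
    show ?thesis unfolding expand by (simp add: algebra_simps power2_eq_square)
  qed
  also have "cmod (- (of_real (1 - cmod a) * (a + of_real (cmod a) * z)) / (a * (1 - cnj a * z)))
               = (1 - cmod a) * (cmod (a + of_real (cmod a) * z) / cmod a / cmod (1 - cnj a * z))"
    using a by (simp add: norm_mult norm_divide del: of_real_diff)
  also have "\<dots> \<le> (1 - cmod a) * (2 / (1 - cmod z))"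
  proof (intro mult_left_mono frac_le)
    have "cmod (a + of_real (cmod a) * z) \<le> cmod a + cmod a * cmod z"
      using norm_triangle_ineq[of a "of_real (cmod a) * z"] by (simp add: norm_mult)
    also have "\<dots> \<le> cmod a * 2" using mult_left_mono[of "cmod z" 1 "cmod a"] z by simp
    finally show "cmod (a + of_real (cmod a) * z) / cmod a \<le> 2"
      using False by (simp add: field_simps)
    have "cmod (cnj a * z) \<le> cmod z"
      using a by (auto simp: norm_mult intro: mult_left_le_one_le)
    thus "1 - cmod z \<le> cmod (1 - cnj a * z)"
      using norm_triangle_ineq2[of 1 "cnj a * z"] by simp
  qed (use a z in auto)
  finally show ?thesis by (simp add: mult.commute)
qed

lemma blaschke_product_LIMSEQ:
  assumes "blaschke_sequence J a" and z: "cmod z < 1"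
  shows "(\<lambda>n. \<Prod>i\<le>n. if i \<in> J then blaschke_factor (a i) z else 1) \<longlonglongrightarrow> blaschke_product J a z"
proof -
  have aJ: "cmod (a n) < 1" if "n \<in> J" for n
    using assms(1) that by (auto simp: blaschke_sequence_def)
  \<comment> \<open>Extension by zero off \<open>J\<close> turns the unordered sum over
    \<open>J\<close> into an ordinary series.\<close>
  define g where "g n = (if n \<in> J then 1 - cmod (a n) else 0)" for n
  have "g summable_on UNIV \<longleftrightarrow> (\<lambda>n. 1 - cmod (a n)) summable_on J"
    by (rule summable_on_cong_neutral) (auto simp: g_def)
  hence "g summable_on UNIV" using assms(1) by (simp add: blaschke_sequence_def)
  hence "summable g" by (rule summable_on_imp_summable)
  have "summable (\<lambda>n. norm ((if n \<in> J then blaschke_factor (a n) z else 1) - 1))"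
  proof (rule summable_comparison_test'[OF summable_mult[OF \<open>summable g\<close>, of "2 / (1 - cmod z)"]])
    show "norm (norm ((if n \<in> J then blaschke_factor (a n) z else 1) - 1)) \<le> 2 / (1 - cmod z) * g n" for n
      using blaschke_factor_minus_1[OF aJ z] by (auto simp: g_def)
  qed
  hence "convergent_prod (\<lambda>n. if n \<in> J then blaschke_factor (a n) z else 1)"
    by (intro abs_convergent_prod_imp_convergent_prod summable_imp_abs_convergent_prod)
  thus ?thesis unfolding blaschke_product_def by (rule convergent_prod_LIMSEQ)
qed

text \<open>Both bounds hold for partial products and pass to the limit. The hypothesis of the
  second ranges over finite subsets of \<open>J\<close> so that an unordered sum over
  \<open>J\<close> can supply \<open>T\<close>.\<close>

lemma blaschke_product_bounds:
  assumes B: "blaschke_sequence J a" and z: "cmod z < 1"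
  shows "cmod (blaschke_product J a z) \<le> 1"
    and "(\<And>F. finite F \<Longrightarrow> F \<subseteq> J \<Longrightarrow> (\<Sum>n\<in>F. 1 - (cmod (blaschke_factor (a n) z))\<^sup>2) \<le> T) \<Longrightarrow>
           1 - (cmod (blaschke_product J a z))\<^sup>2 \<le> T"
proof -
  have aJ: "cmod (a n) < 1" if "n \<in> J" for n
    using B that by (auto simp: blaschke_sequence_def)
  define b where "b i = (if i \<in> J then blaschke_factor (a i) z else 1)" for i
  have lim: "(\<lambda>n. \<Prod>i\<le>n. b i) \<longlonglongrightarrow> blaschke_product J a z"
    unfolding b_def by (rule blaschke_product_LIMSEQ[OF B z])
  have b1: "cmod (b i) \<le> 1" for i
    using blaschke_factor_norm_le_1[OF aJ z] by (auto simp: b_def)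
  have "cmod (\<Prod>i\<le>n. b i) \<le> 1" for n
    unfolding prod_norm[symmetric] by (intro prod_le_1) (auto simp: b1)
  thus "cmod (blaschke_product J a z) \<le> 1"
    by (intro LIMSEQ_le_const2[OF tendsto_norm[OF lim]]) auto
  assume T: "\<And>F. finite F \<Longrightarrow> F \<subseteq> J \<Longrightarrow> (\<Sum>n\<in>F. 1 - (cmod (blaschke_factor (a n) z))\<^sup>2) \<le> T"
  have "1 - (cmod (\<Prod>i\<le>n. b i))\<^sup>2 \<le> T" for n
  proof -
    \<comment> \<open>The inequality 1 - sum x_i \<le> prod (1 - x_i) is applied with x_i = 1 -
      |b_i|^2. Indices outside \<open>J\<close> have x_i = 0.\<close>
    have "1 - (\<Sum>i\<le>n. 1 - (cmod (b i))\<^sup>2) \<le> (\<Prod>i\<le>n. 1 - (1 - (cmod (b i))\<^sup>2))"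
      by (rule Weierstrass_prod_ineq) (auto simp: b1 power_le_one)
    also have "\<dots> = (cmod (\<Prod>i\<le>n. b i))\<^sup>2"
      by (simp add: prod_norm[symmetric] prod_power_distrib)
    also have "(\<Sum>i\<le>n. 1 - (cmod (b i))\<^sup>2) = (\<Sum>i\<in>{..n} \<inter> J. 1 - (cmod (blaschke_factor (a i) z))\<^sup>2)"
      by (rule sum.mono_neutral_cong_right) (auto simp: b_def)
    finally show ?thesis using T[of "{..n} \<inter> J"] by simp
  qed
  thus "1 - (cmod (blaschke_product J a z))\<^sup>2 \<le> T"
    by (intro LIMSEQ_le_const2[OF tendsto_diff[OF tendsto_const tendsto_power[OF tendsto_norm[OF lim]]]]) auto
qed

section \<open>The Poisson kernel and the singular inner factor\<close>

lemma poisson_kernel: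
  assumes w: "cmod w = 1" and z: "cmod z < 1"
  shows "Re ((w + z) / (w - z)) = (1 - (cmod z)\<^sup>2) / (cmod (1 - cnj w * z))\<^sup>2"
proof -
  have "Re ((w + z) / (w - z)) = Re ((w + z) * cnj (w - z)) / (cmod (w - z))\<^sup>2"
    by (simp add: complex_div_cnj[of "w + z"] Re_divide_of_real[symmetric])
  also have "Re ((w + z) * cnj (w - z)) = (cmod w)\<^sup>2 - (cmod z)\<^sup>2"
    unfolding cmod_power2 by (simp add: power2_eq_square algebra_simps)
  \<comment> \<open>For |w| = 1 the two moduli agree. Writing the denominator this way lets one
    kernel estimate serve both the Blaschke zeros and the measure.\<close>
  also have "(cmod (w - z))\<^sup>2 = (cmod (1 - cnj w * z))\<^sup>2"
    using norm_one_minus_cnj_mult[of w z] w by simp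
  finally show ?thesis using w by simp
qed

text \<open>The modulus of the singular factor is exp(-p), where p is the Poisson integral of
  \<open>\<mu>\<close>. Squaring doubles the exponent, and 1 - exp(-2p) \<le> 2p gives the factor
  2.\<close>

lemma singular_inner_bounds:
  assumes sets: "sets \<mu> = sets circle_borel" and fin: "finite_measure \<mu>" and z: "cmod z < 1"
  shows "cmod (singular_inner \<mu> z) \<le> 1"
    and "0 \<le> T \<Longrightarrow> (\<integral>\<^sup>+w. ennreal ((1 - (cmod z)\<^sup>2) / (cmod (1 - cnj w * z))\<^sup>2) \<partial>\<mu>) \<le> ennreal T \<Longrightarrow>
           1 - (cmod (singular_inner \<mu> z))\<^sup>2 \<le> 2 * T"
proof -
  interpret finite_measure \<mu> by (rule fin)
  have space: "space \<mu> = sphere 0 1"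
    using sets_eq_imp_space_eq[OF sets] by (simp add: space_restrict_space)
  define P where "P w = (1 - (cmod z)\<^sup>2) / (cmod (1 - cnj w * z))\<^sup>2" for w
  have P0: "P w \<ge> 0" for w using z by (simp add: P_def power_le_one)
  have "(\<lambda>w. (w + z) / (w - z)) \<in> borel_measurable \<mu>"
    unfolding measurable_cong_sets[OF sets refl] by (intro measurable_restrict_space1) measurable
  \<comment> \<open>A bounded integrand is integrable for the finite measure \<open>\<mu>\<close>,
    which allows the real part to be taken under the integral.\<close>
  moreover have "cmod ((w + z) / (w - z)) \<le> 2 / (1 - cmod z)" if "w \<in> space \<mu>" for w
    unfolding norm_divide
    using that z space norm_triangle_ineq[of w z] norm_triangle_ineq2[of w z]
    by (intro frac_le) auto
  ultimately have int: "integrable \<mu> (\<lambda>w. (w + z) / (w - z))"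
    by (intro integrable_const_bound[of _ "2 / (1 - cmod z)"]) auto
  have PR: "Re ((w + z) / (w - z)) = P w" if "w \<in> space \<mu>" for w
    unfolding P_def using that space by (intro poisson_kernel z) auto
  have "Re (LINT w|\<mu>. (w + z) / (w - z)) = (LINT w|\<mu>. Re ((w + z) / (w - z)))"
    using int by simp
  also have "\<dots> = (LINT w|\<mu>. P w)"
    by (intro Bochner_Integration.integral_cong refl PR)
  finally have S: "cmod (singular_inner \<mu> z) = exp (- (LINT w|\<mu>. P w))"
    by (simp add: singular_inner_def)
  show "cmod (singular_inner \<mu> z) \<le> 1"
    unfolding S using P0 by (simp add: integral_nonneg_AE)
  assume T: "0 \<le> T" "(\<integral>\<^sup>+w. ennreal ((1 - (cmod z)\<^sup>2) / (cmod (1 - cnj w * z))\<^sup>2) \<partial>\<mu>) \<le> ennreal T"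
  have "(LINT w|\<mu>. P w) \<le> T"
    by (intro integral_real_bounded T(1)) (use T(2) in \<open>simp add: P_def\<close>)
  moreover have "(cmod (singular_inner \<mu> z))\<^sup>2 = exp (- 2 * (LINT w|\<mu>. P w))"
    unfolding S by (simp flip: exp_of_nat_mult)
  ultimately show "1 - (cmod (singular_inner \<mu> z))\<^sup>2 \<le> 2 * T"
    using exp_ge_add_one_self[of "- 2 * (LINT w|\<mu>. P w)"] by simp
qed

section \<open>Comparison of the kernel with an admissible function\<close>

lemma admissible_kernel_bound:
  assumes \<phi>: "admissible \<phi>" and \<zeta>: "cmod \<zeta> = 1" and w: "cmod w \<le> 1" "w \<noteq> \<zeta>"
    and r: "0 < r" "r < 1"
  shows "1 / (cmod (1 - cnj w * (of_real r * \<zeta>)))\<^sup>2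
           \<le> 4 * \<phi> (1 - r) / (1 - r)\<^sup>2 * (1 / \<phi> (cmod (\<zeta> - w)))"
proof -
  define d where "d = cmod (\<zeta> - w)"
  define D where "D = cmod (1 - cnj w * (of_real r * \<zeta>))"
  define \<rho> where "\<rho> = 1 - r"
  have pos: "d > 0" "\<rho> > 0" using w r by (auto simp: d_def \<rho>_def)
  hence \<phi>pos: "\<phi> d > 0" "\<phi> \<rho> > 0" using \<phi> by (auto simp: admissible_def)
  have "cmod (cnj w * (of_real r * \<zeta>)) \<le> r"
    using w r \<zeta> by (auto simp: norm_mult intro: mult_left_le_one_le)
  hence D1: "D \<ge> \<rho>"
    using norm_triangle_ineq2[of 1 "cnj w * (of_real r * \<zeta>)"] by (simp add: D_def \<rho>_def)
  \<comment> \<open>Since |\<zeta>| = 1, \<open>d\<close> equals the modulus of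
    \<open>1 - cnj w * \<zeta>\<close>. Moving from \<zeta> to r \<zeta> costs at most
    \<open>\<rho>\<close>, so d \<le> D + \<rho> \<le> 2 D.\<close>
  have "\<zeta> * cnj \<zeta> = 1" using complex_norm_square[of \<zeta>] \<zeta> by simp
  hence "1 - cnj w * \<zeta> = \<zeta> * cnj (\<zeta> - w)" by (simp add: algebra_simps)
  hence "d = cmod (1 - cnj w * \<zeta>)" using \<zeta> by (simp add: d_def norm_mult flip: complex_cnj_diff)
  also have "1 - cnj w * \<zeta> = (1 - cnj w * (of_real r * \<zeta>)) - cnj w * \<zeta> * of_real \<rho>"
    by (simp add: \<rho>_def algebra_simps)
  also have "cmod \<dots> \<le> D + cmod (cnj w * \<zeta> * of_real \<rho>)"
    unfolding D_def by (rule norm_triangle_ineq4)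
  also have "cmod (cnj w * \<zeta> * of_real \<rho>) \<le> \<rho>"
    using w \<zeta> pos by (simp add: norm_mult mult_left_le_one_le)
  finally have D2: "d \<le> 2 * D" using D1 by simp
  \<comment> \<open>For d \<le> \<rho> monotonicity of \<open>\<phi>\<close> and \<rho> \<le> D
    suffice. For d > \<rho> the decrease of \<phi>(x)/x^2 is combined with d \<le> 2 D, whose square
    produces the constant 4.\<close>
  have "\<rho>\<^sup>2 * \<phi> d \<le> 4 * \<phi> \<rho> * D\<^sup>2"
  proof (cases "d \<le> \<rho>")
    case True
    hence "\<phi> d \<le> \<phi> \<rho>" using \<phi> pos by (auto simp: admissible_def mono_on_def)
    hence "\<rho>\<^sup>2 * \<phi> d \<le> D\<^sup>2 * \<phi> \<rho>"
      using D1 pos \<phi>pos by (intro mult_mono power_mono) auto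
    also have "\<dots> \<le> 4 * \<phi> \<rho> * D\<^sup>2" using \<phi>pos by simp
    finally show ?thesis .
  next
    case False
    hence "\<phi> d / d\<^sup>2 \<le> \<phi> \<rho> / \<rho>\<^sup>2"
      using \<phi> pos by (auto simp: admissible_def monotone_on_def)
    hence "\<rho>\<^sup>2 * \<phi> d \<le> \<phi> \<rho> * d\<^sup>2" using pos by (simp add: field_simps)
    also have "d\<^sup>2 \<le> (2 * D)\<^sup>2" using D2 pos by (intro power_mono) auto
    finally show ?thesis using \<phi>pos by (simp add: power_mult_distrib mult_ac)
  qed
  moreover have "D > 0" using D1 pos by simp
  ultimately show ?thesis
    using pos \<phi>pos unfolding D_def[symmetric] d_def[symmetric] \<rho>_def[symmetric]
    by (simp add: field_simps)
qed

section \<open>The radial growth estimate\<close>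

theorem theorem1p5:
  fixes I :: "complex \<Rightarrow> complex" and J :: "nat set" and a :: "nat \<Rightarrow> complex"
    and \<mu> :: "complex measure" and \<phi> :: "real \<Rightarrow> real" and \<zeta> :: complex
  assumes "inner_function I"
    and "blaschke_sequence J a"
    and "singular_circle_measure \<mu>"
    and "\<And>z. z \<in> ball 0 1 \<Longrightarrow> I z = blaschke_product J a z * singular_inner \<mu> z"
    and "admissible \<phi>"
    and "\<zeta> \<in> sphere 0 1"
    and "(\<Sum>\<^sub>\<infinity>n\<in>J. ennreal (1 - cmod (a n)) * recip_ext \<phi> (cmod (\<zeta> - a n)))
           + (\<integral>\<^sup>+w. recip_ext \<phi> (cmod (\<zeta> - w)) \<partial>\<mu>) < \<infinity>"
  shows "\<forall>f \<in> model_space I. \<exists>C>0. \<forall>r\<in>{0<..<1}.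
           cmod (f (of_real r * \<zeta>)) \<le> C * (sqrt (\<phi> (1 - r)) / (1 - r))"
proof
  fix f assume f: "f \<in> model_space I"
  have aJ: "cmod (a n) < 1" if "n \<in> J" for n
    using assms(2) that by (auto simp: blaschke_sequence_def)
  have \<zeta>: "cmod \<zeta> = 1" using assms(6) by simp
  have \<phi>pos: "\<phi> x > 0" if "x > 0" for x using assms(5) that by (simp add: admissible_def)
  have \<mu>: "sets \<mu> = sets circle_borel" "finite_measure \<mu>"
    using assms(3) by (auto simp: singular_circle_measure_def)
  have space: "space \<mu> = sphere 0 1"
    using sets_eq_imp_space_eq[OF \<mu>(1)] by (simp add: space_restrict_space)
  have I1: "cmod (I z) \<le> 1" if "z \<in> ball 0 1" for z
    using that assms(4)[OF that] blaschke_product_bounds(1)[OF assms(2), of z]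
      singular_inner_bounds(1)[OF \<mu>, of z]
    by (simp add: norm_mult mult_le_one)
  have Ih: "I holomorphic_on ball 0 1" using assms(1) by (simp add: inner_function_def)
  define X where "X = (\<Sum>\<^sub>\<infinity>n\<in>J. ennreal (1 - cmod (a n)) * recip_ext \<phi> (cmod (\<zeta> - a n)))"
  define Y where "Y = (\<integral>\<^sup>+w. recip_ext \<phi> (cmod (\<zeta> - w)) \<partial>\<mu>)"
  have "X < \<infinity>" "Y < \<infinity>" using assms(7) by (auto simp: X_def Y_def ennreal_add_less_top)
  then obtain x y where x: "x \<ge> 0" "X = ennreal x" and y: "y \<ge> 0" "Y = ennreal y"
    by (metis ennreal_cases infinity_ennreal_def less_irrefl)
  define M where "M = (\<Sum>n. (cmod (taylor f n))\<^sup>2)"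
  have M0: "M \<ge> 0"
    using f unfolding M_def by (intro suminf_nonneg) (auto simp: model_space_def hardy2_def)
  \<comment> \<open>The 8 is the 4 of the kernel comparison times a 2, which comes from 1 - |a|^2
    \<le> 2 (1 - |a|) for the zeros and from squaring the exponential for the measure. Adding 1
    keeps \<open>C\<close> positive even if the root vanishes.\<close>
  define C where "C = sqrt (M * (8 * (x + y))) + 1"
  show "\<exists>C>0. \<forall>r\<in>{0<..<1}. cmod (f (of_real r * \<zeta>)) \<le> C * (sqrt (\<phi> (1 - r)) / (1 - r))"
  proof (intro exI[of _ C] conjI ballI)
    show "C > 0" unfolding C_def using M0 x y by (intro add_nonneg_pos) auto
    fix r :: real assume "r \<in> {0<..<1}"
    hence r: "0 < r" "r < 1" by auto
    define z where "z = of_real r * \<zeta>"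
    have zr: "cmod z = r" using r \<zeta> by (simp add: z_def norm_mult)
    have z: "cmod z < 1" using zr r by simp
    have \<phi>r: "\<phi> (1 - r) > 0" using r by (intro \<phi>pos) simp
    define K where "K = 4 * \<phi> (1 - r) / (1 - r)\<^sup>2"
    have K0: "K > 0" using r \<phi>r by (simp add: K_def)
    have ker: "1 / (cmod (1 - cnj w * z))\<^sup>2 \<le> K * (1 / \<phi> (cmod (\<zeta> - w)))"
      if "cmod w \<le> 1" "w \<noteq> \<zeta>" for w
      unfolding K_def z_def by (rule admissible_kernel_bound[OF assms(5) \<zeta> that r])
    have r2: "0 < 1 - r\<^sup>2" using r by (simp add: power_less_one_iff)

    have "1 - (cmod (blaschke_product J a z))\<^sup>2 \<le> 2 * (1 - r\<^sup>2) * K * x"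
    proof (rule blaschke_product_bounds(2)[OF assms(2) z])
      fix F assume F: "finite F" "F \<subseteq> J"
      \<comment> \<open>Zeros lie in the open disk, so they differ from \<open>\<zeta>\<close> and
        \<open>recip_ext\<close> takes its finite branch.\<close>
      have aF: "cmod (a n) < 1" "\<zeta> \<noteq> a n" if "n \<in> F" for n
        using aJ[of n] that F \<zeta> by auto
      have "ennreal (\<Sum>n\<in>F. (1 - cmod (a n)) * (1 / \<phi> (cmod (\<zeta> - a n))))
              = (\<Sum>n\<in>F. ennreal (1 - cmod (a n)) * recip_ext \<phi> (cmod (\<zeta> - a n)))"
      proof (subst sum_ennreal[symmetric])
        fix n assume "n \<in> F"
        thus "0 \<le> (1 - cmod (a n)) * (1 / \<phi> (cmod (\<zeta> - a n)))"
          using aF[of n] \<phi>pos[of "cmod (\<zeta> - a n)"] by simp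
      next
        show "(\<Sum>n\<in>F. ennreal ((1 - cmod (a n)) * (1 / \<phi> (cmod (\<zeta> - a n)))))
              = (\<Sum>n\<in>F. ennreal (1 - cmod (a n)) * recip_ext \<phi> (cmod (\<zeta> - a n)))"
          using aF by (intro sum.cong refl) (auto simp: recip_ext_def less_imp_le simp flip: ennreal_mult')
      qed
      \<comment> \<open>An unordered sum of extended nonnegative reals is the supremum of its finite
        partial sums.\<close>
      also have "\<dots> \<le> X"
        unfolding X_def nonneg_infsum_complete[OF zero_le] using F by (intro SUP_upper) auto
      finally have Fx: "(\<Sum>n\<in>F. (1 - cmod (a n)) * (1 / \<phi> (cmod (\<zeta> - a n)))) \<le> x"
        using x by simp
      have "(\<Sum>n\<in>F. 1 - (cmod (blaschke_factor (a n) z))\<^sup>2)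
              \<le> (\<Sum>n\<in>F. 2 * (1 - r\<^sup>2) * K * ((1 - cmod (a n)) * (1 / \<phi> (cmod (\<zeta> - a n)))))"
      proof (rule sum_mono)
        fix n assume n: "n \<in> F"
        have "1 - (cmod (blaschke_factor (a n) z))\<^sup>2
                = ((1 + cmod (a n)) * (1 - cmod (a n)) * (1 - r\<^sup>2)) * (1 / (cmod (1 - cnj (a n) * z))\<^sup>2)"
        proof -
          have "1 - (cmod (a n))\<^sup>2 = (1 + cmod (a n)) * (1 - cmod (a n))"
            by (simp add: power2_eq_square algebra_simps)
          thus ?thesis unfolding blaschke_factor_norm[OF aF(1)[OF n] z] zr by simp
        qed
        also have "\<dots> \<le> (2 * (1 - cmod (a n)) * (1 - r\<^sup>2)) * (K * (1 / \<phi> (cmod (\<zeta> - a n))))"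
          using aF[OF n] r2 by (intro mult_mono ker) auto
        finally show "1 - (cmod (blaschke_factor (a n) z))\<^sup>2
            \<le> 2 * (1 - r\<^sup>2) * K * ((1 - cmod (a n)) * (1 / \<phi> (cmod (\<zeta> - a n))))"
          by (simp only: mult_ac)
      qed
      also have "\<dots> \<le> 2 * (1 - r\<^sup>2) * K * x"
        unfolding sum_distrib_left[symmetric] using Fx K0 r2 by (intro mult_left_mono) auto
      finally show "(\<Sum>n\<in>F. 1 - (cmod (blaschke_factor (a n) z))\<^sup>2) \<le> 2 * (1 - r\<^sup>2) * K * x" .
    qed
    moreover have "1 - (cmod (singular_inner \<mu> z))\<^sup>2 \<le> 2 * ((1 - r\<^sup>2) * K * y)"
    proof (rule singular_inner_bounds(2)[OF \<mu> z])
      show "0 \<le> (1 - r\<^sup>2) * K * y" using r2 K0 y by simp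
      define c where "c = (1 - r\<^sup>2) * K"
      have c: "c > 0" using r2 K0 by (simp add: c_def)
      have [measurable]: "cnj \<in> borel_measurable borel"
        by (intro borel_measurable_continuous_onI continuous_intros)
      have meas: "(\<lambda>w. ennreal (1 / (K * (cmod (1 - cnj w * z))\<^sup>2))) \<in> borel_measurable \<mu>"
        unfolding measurable_cong_sets[OF \<mu>(1) refl] by (intro measurable_restrict_space1) simp
      \<comment> \<open>The constant is pulled out of the integral of the explicit, measurable
        kernel; the passage to \<open>recip_ext\<close> is then mere monotonicity of the
        integral.\<close>
      have "(\<integral>\<^sup>+w. ennreal ((1 - (cmod z)\<^sup>2) / (cmod (1 - cnj w * z))\<^sup>2) \<partial>\<mu>)
              = (\<integral>\<^sup>+w. ennreal c * ennreal (1 / (K * (cmod (1 - cnj w * z))\<^sup>2)) \<partial>\<mu>)"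
        using c K0 by (intro nn_integral_cong) (simp add: c_def zr flip: ennreal_mult')
      also have "\<dots> = ennreal c * (\<integral>\<^sup>+w. ennreal (1 / (K * (cmod (1 - cnj w * z))\<^sup>2)) \<partial>\<mu>)"
        by (rule nn_integral_cmult[OF meas])
      also have "\<dots> \<le> ennreal c * Y"
        unfolding Y_def
      proof (intro mult_left_mono nn_integral_mono)
        fix w assume "w \<in> space \<mu>"
        hence "cmod w \<le> 1" using space by simp
        \<comment> \<open>At w = \<zeta> the right side is infinite by convention; elsewhere this is
          the kernel comparison divided by \<open>K\<close>.\<close>
        thus "ennreal (1 / (K * (cmod (1 - cnj w * z))\<^sup>2)) \<le> recip_ext \<phi> (cmod (\<zeta> - w))"
          using divide_right_mono[OF ker[of w], of K] K0
          by (auto simp: recip_ext_def mult.commute intro!: ennreal_leI)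
      qed simp
      also have "\<dots> = ennreal ((1 - r\<^sup>2) * K * y)"
        using c y by (simp add: c_def ennreal_mult')
      finally show "(\<integral>\<^sup>+w. ennreal ((1 - (cmod z)\<^sup>2) / (cmod (1 - cnj w * z))\<^sup>2) \<partial>\<mu>)
                      \<le> ennreal ((1 - r\<^sup>2) * K * y)" .
    qed
    moreover have "1 - (cmod (I z))\<^sup>2 \<le> (1 - (cmod (blaschke_product J a z))\<^sup>2) + (1 - (cmod (singular_inner \<mu> z))\<^sup>2)"
    proof -
      \<comment> \<open>Expanding (1 - s)(1 - t) \<ge> 0 gives 1 - s t \<le> (1 - s) + (1 - t), here
        for the squared moduli of the two factors.\<close>
      have "0 \<le> (1 - (cmod (blaschke_product J a z))\<^sup>2) * (1 - (cmod (singular_inner \<mu> z))\<^sup>2)"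
        using blaschke_product_bounds(1)[OF assms(2) z] singular_inner_bounds(1)[OF \<mu> z]
        by (intro mult_nonneg_nonneg) (auto simp: power_le_one)
      thus ?thesis using assms(4)[of z] z
        by (simp add: norm_mult power_mult_distrib algebra_simps)
    qed
    ultimately have I2: "1 - (cmod (I z))\<^sup>2 \<le> 2 * (1 - r\<^sup>2) * K * (x + y)"
      by (simp add: algebra_simps)

    have "(cmod (f z))\<^sup>2 \<le> M * ((1 - (cmod (I z))\<^sup>2) / (1 - r\<^sup>2))"
      using model_space_pointwise_bound[OF Ih I1 f z] by (simp add: M_def zr)
    \<comment> \<open>The factor 1 - r^2 in the bound for 1 - |I(z)|^2 cancels the denominator
      coming from the Szego kernel.\<close>
    also have "\<dots> \<le> M * (2 * K * (x + y))"
      using I2 r2 M0 by (intro mult_left_mono) (auto simp: field_simps)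
    also have "\<dots> = M * (8 * (x + y)) * (\<phi> (1 - r) / (1 - r)\<^sup>2)"
      by (simp add: K_def)
    finally have "cmod (f z) \<le> sqrt (M * (8 * (x + y)) * (\<phi> (1 - r) / (1 - r)\<^sup>2))"
      by (rule real_le_rsqrt)
    also have "\<dots> = sqrt (M * (8 * (x + y))) * (sqrt (\<phi> (1 - r)) / (1 - r))"
      unfolding real_sqrt_mult[of "M * (8 * (x + y))"] using r by (simp add: real_sqrt_divide)
    also have "\<dots> \<le> C * (sqrt (\<phi> (1 - r)) / (1 - r))"
      unfolding C_def using r \<phi>r by (intro mult_right_mono) auto
    finally show "cmod (f (of_real r * \<zeta>)) \<le> C * (sqrt (\<phi> (1 - r)) / (1 - r))"
      by (simp add: z_def)
  qed
qed

end
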